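(* In the financial model (FM) described in the context, let $U\in\mathcal{M}\cap\mathcal{X}_+$ satisfy $\pi(U)=1$, and let $\rho=\rho_{\mathcal{A},\mathcal{M},\pi}:\mathcal{X}\to\overline{\mathbb{R}}$, $\rho(X)=\inf\{\pi(Z)\mid Z\in\mathcal{M},\ X+Z\in\mathcal{A}\}$. Then $\rho$ is proper if and only if $\mathcal{A}+\ker\pi$ does not contain lines parallel to $U$, i.e. $$X+\mathbb{R}U\not\subseteq\mathcal{A}+\ker\pi\qquad\text{for all }X\in\mathcal{A}+\ker\pi.$$
   Context: Financial model (FM). $\mathcal{X}$ is a real vector space (the capital positions, typically random variables on a probability space $(\Omega,\mathcal{F},\mathbb{P})$ identified $\mathbb{P}$-a.s.), partially ordered by a pointed convex cone $\mathcal{X}_+=\{X\in\mathcal{X}\mid 0\le X\}$ (for random variables, $0\le X$ means $X\ge 0$ $\mathbb{P}$-a.s.). There are eligible assets $S^i=(S_0^i,S_1^i)\in\mathbb{R}\times\mathcal{X}$, $i=0,\dots,N$, with price $S_0^i$ and payoff $S_1^i$; $S^0=(1,1)$ is the secure asset, whose payoff $1\in\mathcal{X}_+$ is the constant payoff. The payoffs are linearly independent, $\mathcal{M}=\mathrm{span}(1,S_1^1,\dots,S_1^N)\subseteq\mathcal{X}$, and $1<\dim\mathcal{M}<+\infty$. For $x\in\mathbb{R}^{N+1}$ put $S_j^Tx=\sum_{i=0}^N x_iS_j^i$, $j\in\{0,1\}$. The Law of One Price holds ($S_0^Tx$ depends only on the payoff $S_1^Tx$), so $\pi:\mathcal{M}\to\mathbb{R}$,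 $\pi(Z):=S_0^Tx$ for any $x$ with $Z=S_1^Tx$, is a well-defined linear functional. The no-arbitrage principle holds: if $S_0^Tx\le 0$ and $S_1^Tx\ge 0$, then $S_0^Tx=0$ and $S_1^Tx=0$. $\mathcal{A}\subseteq\mathcal{X}$ is an acceptance set: $0\in\mathcal{A}$, $\mathcal{A}\neq\mathcal{X}$, $\mathcal{A}+\mathcal{X}_+\subseteq\mathcal{A}$. Notation: $\overline{\mathbb{R}}=\mathbb{R}\cup\{\pm\infty\}$, $\inf\emptyset=+\infty$, $\ker\pi=\{Z\in\mathcal{M}\mid\pi(Z)=0\}$; sums of sets are Minkowski sums, $X+\mathbb{R}U=\{X+tU\mid t\in\mathbb{R}\}$. A functional $f:\mathcal{X}\to\overline{\mathbb{R}}$ is proper if $\{X\in\mathcal{X}\mid f(X)<+\infty\}\neq\emptyset$ and $f(X)>-\infty$ for all $X\in\mathcal{X}$. *)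

theory Defs
  imports "HOL-Analysis.Analysis" "HOL-Library.Set_Algebras"
begin

text \<open>
  The space of capital positions is an arbitrary type of class \<open>ordered_real_vector\<close>: a real vector
  space with a translation-invariant partial order compatible with nonnegative scaling, i.e. one
  whose positive cone below is a pointed convex cone inducing the order.
\<close>

definition pos_cone :: "'a::ordered_real_vector set" where
  "pos_cone = {X. 0 \<le> X}"

text \<open>
  The eligible assets are indexed by \<open>i \<le> N\<close>; a portfolio with \<open>N + 1\<close> real positions is a function \<open>nat \<Rightarrow> real\<close> of which
  only the values at \<open>i \<le> N\<close> matter.
\<close>

definition portfolio_price :: "nat \<Rightarrow> (nat \<Rightarrow> real) \<Rightarrow> (nat \<Rightarrow> real) \<Rightarrow> real" where
  "portfolio_price N S0 x = (\<Sum>i\<le>N. x i * S0 i)"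

definition portfolio_payoff ::
    "nat \<Rightarrow> (nat \<Rightarrow> 'a::real_vector) \<Rightarrow> (nat \<Rightarrow> real) \<Rightarrow> 'a" where
  "portfolio_payoff N S1 x = (\<Sum>i\<le>N. x i *\<^sub>R S1 i)"

definition eligible_payoffs :: "nat \<Rightarrow> (nat \<Rightarrow> 'a::real_vector) \<Rightarrow> 'a set" where
  "eligible_payoffs N S1 = span (S1 ` {..N})"

text \<open>Meaningful only on the eligible payoffs, and only under the Law of One Price.\<close>

definition pricing ::
    "nat \<Rightarrow> (nat \<Rightarrow> real) \<Rightarrow> (nat \<Rightarrow> 'a::real_vector) \<Rightarrow> 'a \<Rightarrow> real" where
  "pricing N S0 S1 Z =
     (THE p. \<exists>x. Z = portfolio_payoff N S1 x \<and> p = portfolio_price N S0 x)"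

definition pricing_kernel ::
    "nat \<Rightarrow> (nat \<Rightarrow> real) \<Rightarrow> (nat \<Rightarrow> 'a::real_vector) \<Rightarrow> 'a set" where
  "pricing_kernel N S0 S1 = {Z \<in> eligible_payoffs N S1. pricing N S0 S1 Z = 0}"

definition acceptance_set :: "'a::ordered_real_vector set \<Rightarrow> bool" where
  "acceptance_set A \<longleftrightarrow> 0 \<in> A \<and> A \<noteq> UNIV \<and> A + pos_cone \<subseteq> A"

text \<open>
  The secure asset is the one with index 0; its payoff \<open>S1 0\<close> is the distinguished positive
  element \<open>1\<close> of the space. The eligible payoffs are finitely spanned, so their dimension is finite.
\<close>

locale financial_model =
  fixes N :: nat
    and S0 :: "nat \<Rightarrow> real"
    and S1 :: "nat \<Rightarrow> 'a::ordered_real_vector"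
    and A :: "'a set"
  assumes secure_price: "S0 0 = 1"
    and secure_payoff: "S1 0 \<in> pos_cone"
    and payoffs_distinct: "inj_on S1 {..N}"
    and payoffs_independent: "independent (S1 ` {..N})"
    and dim_eligible: "1 < dim (eligible_payoffs N S1)"
    and law_of_one_price:
      "\<And>x y. portfolio_payoff N S1 x = portfolio_payoff N S1 y \<Longrightarrow>
        portfolio_price N S0 x = portfolio_price N S0 y"
    and no_arbitrage:
      "\<And>x. portfolio_price N S0 x \<le> 0 \<Longrightarrow> 0 \<le> portfolio_payoff N S1 x \<Longrightarrow>
        portfolio_price N S0 x = 0 \<and> portfolio_payoff N S1 x = 0"
    and acceptance: "acceptance_set A"

text \<open>In \<open>ereal\<close> the infimum of the empty set is \<open>\<infinity>\<close>.\<close>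

definition risk_measure ::
    "'a::real_vector set \<Rightarrow> 'a set \<Rightarrow> ('a \<Rightarrow> real) \<Rightarrow> 'a \<Rightarrow> ereal" where
  "risk_measure A M p X = Inf {ereal (p Z) |Z. Z \<in> M \<and> X + Z \<in> A}"

definition proper_functional :: "('a \<Rightarrow> ereal) \<Rightarrow> bool" where
  "proper_functional f \<longleftrightarrow> {X. f X < \<infinity>} \<noteq> {} \<and> (\<forall>X. f X > - \<infinity>)"

definition line_through :: "'a::real_vector \<Rightarrow> 'a \<Rightarrow> 'a set" where
  "line_through X U = range (\<lambda>t. X + t *\<^sub>R U)"

end

theory Submission
  imports Defs
begin

text \<open>
  Since \<open>\<pi> U = 1\<close>, every eligible payoff of price \<open>t\<close> differs from \<open>t U\<close> by an element of the
  pricing kernel. Hence the risk measure is the infimum of all \<open>t\<close> with \<open>X + t U \<in> A + ker \<pi>\<close>. As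
  \<open>U\<close> is positive and \<open>A\<close> is monotone, these \<open>t\<close> form an upward closed set, so the infimum is
  \<open>-\<infinity>\<close> exactly when the whole line through \<open>X\<close> lies in \<open>A + ker \<pi>\<close>.
\<close>

lemma portfolio_payoff_add:
  "portfolio_payoff N S1 (\<lambda>i. x i + y i) = portfolio_payoff N S1 x + portfolio_payoff N S1 y"
  by (simp add: portfolio_payoff_def scaleR_add_left sum.distrib)

lemma portfolio_payoff_scale:
  "portfolio_payoff N S1 (\<lambda>i. c * x i) = c *\<^sub>R portfolio_payoff N S1 x"
  by (simp add: portfolio_payoff_def scaleR_sum_right)

lemma portfolio_price_add:
  "portfolio_price N S0 (\<lambda>i. x i + y i) = portfolio_price N S0 x + portfolio_price N S0 y"
  by (simp add: portfolio_price_def distrib_right sum.distrib)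

lemma portfolio_price_scale:
  "portfolio_price N S0 (\<lambda>i. c * x i) = c * portfolio_price N S0 x"
  by (simp add: portfolio_price_def sum_distrib_left mult.assoc)

lemma acceptance_set_add_nonneg:
  assumes "acceptance_set A" "X \<in> A" "0 \<le> Y"
  shows "X + Y \<in> A"
  using assms unfolding acceptance_set_def pos_cone_def by (blast intro: set_plus_intro)

text \<open>If the infimum is -\<infinity>, every real \<open>t\<close> has some member of
  \<open>T\<close> strictly below it, and upward closure then puts \<open>t\<close> into
  \<open>T\<close>.\<close>

lemma Inf_ereal_eq_MInfty_iff:
  assumes "\<And>s t. s \<in> T \<Longrightarrow> s \<le> t \<Longrightarrow> t \<in> T"
  shows "Inf (ereal ` T) = -\<infinity> \<longleftrightarrow> T = UNIV"
proof
  assume inf: "Inf (ereal ` T) = -\<infinity>"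
  have "t \<in> T" for t
  proof -
    have "Inf (ereal ` T) < ereal t" by (simp add: inf)
    then obtain s where "s \<in> T" "s < t" by (auto simp: Inf_less_iff)
    then show ?thesis using assms less_imp_le by blast
  qed
  then show "T = UNIV" by blast
next
  assume "T = UNIV"
  then have "Inf (ereal ` T) \<le> ereal t" for t by (intro INF_lower) simp
  then show "Inf (ereal ` T) = -\<infinity>" by (intro ereal_bot) blast
qed

context financial_model
begin

abbreviation "M \<equiv> eligible_payoffs N S1"
abbreviation "\<pi> \<equiv> pricing N S0 S1"
abbreviation "K \<equiv> pricing_kernel N S0 S1"

text \<open>The Law of One Price makes the definite description in \<open>pricing\<close> well
  defined; linearity of \<pi> is then inherited from portfolios.\<close>

lemma pricing_payoff: "\<pi> (portfolio_payoff N S1 x) = portfolio_price N S0 x"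
  unfolding pricing_def by (intro the_equality) (auto dest: law_of_one_price)

lemma eligible_payoffs_eq: "M = range (portfolio_payoff N S1)"
proof
  \<comment> \<open>Since distinct assets have distinct payoffs, coefficients attached to payoffs
    can be reindexed as positions in the assets.\<close>
  have sum_eq: "(\<Sum>v\<in>S1 ` {..N}. u v *\<^sub>R v) = portfolio_payoff N S1 (u \<circ> S1)" for u
    by (simp add: portfolio_payoff_def sum.reindex[OF payoffs_distinct])
  then show "M \<subseteq> range (portfolio_payoff N S1)"
    by (auto simp: eligible_payoffs_def span_finite)
  show "range (portfolio_payoff N S1) \<subseteq> M"
    by (auto simp: eligible_payoffs_def portfolio_payoff_def
        intro!: span_sum span_scale intro: span_base)
qed

lemma pricing_add:
  assumes "Y \<in> M" "Z \<in> M"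
  shows "\<pi> (Y + Z) = \<pi> Y + \<pi> Z"
  using assms
  by (auto simp: eligible_payoffs_eq pricing_payoff portfolio_price_add
      simp flip: portfolio_payoff_add)

lemma pricing_scale:
  assumes "Z \<in> M"
  shows "\<pi> (c *\<^sub>R Z) = c * \<pi> Z"
  using assms
  by (auto simp: eligible_payoffs_eq pricing_payoff portfolio_price_scale
      simp flip: portfolio_payoff_scale)

lemma pricing_diff:
  assumes "Y \<in> M" "Z \<in> M"
  shows "\<pi> (Y - Z) = \<pi> Y - \<pi> Z"
proof -
  have "Y - Z \<in> M" using assms by (simp add: eligible_payoffs_def span_diff)
  from pricing_add[OF this assms(2)] show ?thesis by simp
qed

lemma mem_acceptance_plus_kernel_iff:
  assumes U: "U \<in> M" "\<pi> U = 1"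
  shows "X + t *\<^sub>R U \<in> A + K \<longleftrightarrow> (\<exists>Z\<in>M. \<pi> Z = t \<and> X + Z \<in> A)"
proof
  have tU: "t *\<^sub>R U \<in> M" "\<pi> (t *\<^sub>R U) = t"
    using U by (simp_all add: pricing_scale) (simp add: eligible_payoffs_def span_scale)
  {
    assume "X + t *\<^sub>R U \<in> A + K"
    then obtain a k where ak: "a \<in> A" "k \<in> M" "\<pi> k = 0" "X + t *\<^sub>R U = a + k"
      by (auto simp: pricing_kernel_def elim: set_plus_elim)
    \<comment> \<open>The witness is \<open>Z = t U - k\<close>: subtracting the zero-price
      \<open>k\<close> keeps the price \<open>t\<close>.\<close>
    from ak(4) have "X + (t *\<^sub>R U - k) = a"
      by (metis add_diff_cancel_right' add_diff_eq)
    moreover have "t *\<^sub>R U - k \<in> M"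
      using ak tU by (simp add: eligible_payoffs_def span_diff)
    ultimately show "\<exists>Z\<in>M. \<pi> Z = t \<and> X + Z \<in> A"
      using ak tU by (auto simp: pricing_diff intro!: bexI[of _ "t *\<^sub>R U - k"])
  next
    assume "\<exists>Z\<in>M. \<pi> Z = t \<and> X + Z \<in> A"
    then obtain Z where Z: "Z \<in> M" "\<pi> Z = t" "X + Z \<in> A" by blast
    \<comment> \<open>Conversely, \<open>t U - Z\<close> has price \<open>t - t = 0\<close> and
      serves as the kernel summand.\<close>
    have "t *\<^sub>R U - Z \<in> M"
      using Z tU by (simp add: eligible_payoffs_def span_diff)
    then have "t *\<^sub>R U - Z \<in> K"
      using Z tU by (simp add: pricing_kernel_def pricing_diff)
    with Z(3) have "(X + Z) + (t *\<^sub>R U - Z) \<in> A + K" by (rule set_plus_intro)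
    then show "X + t *\<^sub>R U \<in> A + K" by simp
  }
qed

text \<open>Sorting the admissible \<open>Z\<close> by their price \<open>t\<close> shows that the
  two sets of reals coincide, not only their infima.\<close>

lemma risk_measure_eq:
  assumes "U \<in> M" "\<pi> U = 1"
  shows "risk_measure A M \<pi> X = Inf (ereal ` {t. X + t *\<^sub>R U \<in> A + K})"
proof -
  have "{ereal (\<pi> Z) |Z. Z \<in> M \<and> X + Z \<in> A} = ereal ` {t. X + t *\<^sub>R U \<in> A + K}"
    unfolding mem_acceptance_plus_kernel_iff[OF assms] by auto
  then show ?thesis by (simp add: risk_measure_def)
qed

lemma risk_measure_eq_MInfty_iff:
  assumes "U \<in> M" "\<pi> U = 1" "0 \<le> U"
  shows "risk_measure A M \<pi> X = -\<infinity> \<longleftrightarrow> line_through X U \<subseteq> A + K"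
proof -
  have "X + t *\<^sub>R U \<in> A + K" if mem: "X + s *\<^sub>R U \<in> A + K" and "s \<le> t" for s t
  proof -
    obtain a k where ak: "a \<in> A" "k \<in> K" "X + s *\<^sub>R U = a + k"
      using mem by (auto elim: set_plus_elim)
    \<comment> \<open>Moving up the line from \<open>s\<close> to \<open>t\<close> adds a
      nonnegative multiple of \<open>U\<close>, which the acceptable summand absorbs while
      \<open>k\<close> stays fixed.\<close>
    have "a + (t - s) *\<^sub>R U \<in> A"
      using acceptance_set_add_nonneg[OF acceptance ak(1)] assms(3) \<open>s \<le> t\<close>
      by (simp add: scaleR_nonneg_nonneg)
    then have "(a + (t - s) *\<^sub>R U) + k \<in> A + K"
      using ak(2) by (rule set_plus_intro)
    moreover have "X + t *\<^sub>R U = (X + s *\<^sub>R U) + (t - s) *\<^sub>R U"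
      by (simp add: scaleR_diff_left)
    then have "X + t *\<^sub>R U = (a + (t - s) *\<^sub>R U) + k"
      by (simp add: ak(3) ac_simps)
    ultimately show ?thesis by simp
  qed
  then show ?thesis
    by (subst risk_measure_eq[OF assms(1,2)], subst Inf_ereal_eq_MInfty_iff)
      (auto simp: line_through_def)
qed

text \<open>This settles the nonempty domain in properness: at the zero position,
  \<open>Z = 0\<close> is admissible because \<open>0\<close> is acceptable.\<close>

lemma risk_measure_zero_less_PInfty: "risk_measure A M \<pi> 0 < \<infinity>"
proof -
  have "0 \<in> M" by (simp add: eligible_payoffs_def span_zero)
  moreover have "0 \<in> A" using acceptance by (simp add: acceptance_set_def)
  ultimately have "risk_measure A M \<pi> 0 \<le> ereal (\<pi> 0)"
    unfolding risk_measure_def by (intro Inf_lower) force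
  then show ?thesis by (rule le_less_trans) simp
qed

end

theorem theorem5p25:
  fixes N :: nat
    and S0 :: "nat \<Rightarrow> real"
    and S1 :: "nat \<Rightarrow> 'a::ordered_real_vector"
    and A :: "'a set"
    and U :: 'a
  assumes "financial_model N S0 S1 A"
    and "U \<in> eligible_payoffs N S1 \<inter> pos_cone"
    and "pricing N S0 S1 U = 1"
  shows "proper_functional (risk_measure A (eligible_payoffs N S1) (pricing N S0 S1)) \<longleftrightarrow>
    (\<forall>X \<in> A + pricing_kernel N S0 S1.
       \<not> line_through X U \<subseteq> A + pricing_kernel N S0 S1)"
proof -
  interpret financial_model N S0 S1 A by fact
  have U: "U \<in> M" "\<pi> U = 1" "0 \<le> U"
    using assms(2,3) by (auto simp: pos_cone_def)
  \<comment> \<open>A line through \<open>X\<close> inside \<open>A + K\<close> forces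
    \<open>X\<close> itself into \<open>A + K\<close>, so the condition may be read over all
    \<open>X\<close>.\<close>
  have "X \<in> line_through X U" for X
    unfolding line_through_def by (rule range_eqI[of _ _ 0]) simp
  then have "(\<forall>X\<in>A + K. \<not> line_through X U \<subseteq> A + K) \<longleftrightarrow> (\<forall>X. \<not> line_through X U \<subseteq> A + K)"
    by blast
  also have "\<dots> \<longleftrightarrow> (\<forall>X. risk_measure A M \<pi> X \<noteq> -\<infinity>)"
    by (simp add: risk_measure_eq_MInfty_iff[OF U])
  also have "\<dots> \<longleftrightarrow> proper_functional (risk_measure A M \<pi>)"
    unfolding proper_functional_def using risk_measure_zero_less_PInfty by auto
  finally show ?thesis ..
qed

end
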